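(* Let $\Phi_N\subset\mathbb{R}^N$ be convex, let $\{\zeta_n\}_{n=1}^N$ be an orthonormal basis of $\mathcal{Z}_N$, and let $\mathbf{L}\in\mathbb{R}^{M,N}$ be full rank with $M\geq N$. Let $\xi\in[0,\infty)$. Given $\mathbf{y}_1,\mathbf{y}_2\in\mathbb{R}^M$, for $i=1,2$ let $\hat{\mathbf{z}}_{\xi,i}\in\Phi_N$ denote the solution to $$ \min_{\mathbf{z}\in\Phi_N}\ \|\mathbf{L}\mathbf{z}-\mathbf{y}_i\|_{\mathbf{W}_\xi}^2 . $$ Then $$ \| \hat{\mathbf{z}}_{\xi,2} - \hat{\mathbf{z}}_{\xi,1} \|_2 \leq \| \mathbf{L}^T \mathbf{W}_{\xi} \|_2 \; \Lambda_{\xi}^{\rm nl}(\Phi_N)\; \| \mathbf{y}_1 - \mathbf{y}_2 \|_2 . $$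
   Context: $\mathcal{U}$ is a real Hilbert space with inner product $(\cdot,\cdot)$; $\ell_1,\ldots,\ell_M\in\mathcal{U}'$ are linearly independent bounded linear functionals with Riesz representers $q_1,\ldots,q_M\in\mathcal{U}$, i.e. $(q_m,v)=\ell_m(v)$ for all $v\in\mathcal{U}$. $\mathcal{Z}_N={\rm span}\{\zeta_n\}_{n=1}^N\subset\mathcal{U}$ is an $N$-dimensional space. $\mathbf{L}_{m,n}=\ell_m(\zeta_n)$, $\mathbf{K}\in\mathbb{R}^{M,M}$ with $\mathbf{K}_{m,m'}=(q_m,q_{m'})$, $\mathbf{W}_\xi=(\xi\mathbf{Id}+\mathbf{K})^{-1}$, $\mathbf{Q}_\xi=\mathbf{L}^T\mathbf{W}_\xi\mathbf{L}$. For a symmetric positive definite matrix $\mathbf{W}$, $\|\mathbf{x}\|_{\mathbf{W}}=\sqrt{\mathbf{x}^T\mathbf{W}\mathbf{x}}$. On vectors $\|\cdot\|_2$ is the Euclidean norm; on matrices it is the induced (spectral) norm. For $\Phi_N\subset\mathbb{R}^N$ (with at least two points), $$ \Lambda_{\xi}^{\rm nl}(\Phi_N)=\left(\min_{\mathbf{z}_1,\mathbf{z}_2\in\Phi_N,\ \mathbf{z}_1\neq\mathbf{z}_2}\frac{\|\mathbf{z}_1-\mathbf{z}_2\|_{\mathbf{Q}_\xi}^2}{\|\mathbf{z}_1-\mathbf{z}_2\|_2^2}\right)^{-1}, $$ where the minimum is understood as an infimum if it is not attained. "The solution" means a minimizer (its existence being presupposed). *)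

theory Defs
  imports "HOL-Analysis.Analysis"
begin

definition orthonormal_basis_of ::
  "('n \<Rightarrow> 'u::real_inner) \<Rightarrow> 'u set \<Rightarrow> bool" where
  "orthonormal_basis_of \<zeta> Z \<longleftrightarrow>
     (\<forall>i j. \<zeta> i \<bullet> \<zeta> j = (if i = j then 1 else 0)) \<and> span (range \<zeta>) = Z"

definition riesz_representers ::
  "('m \<Rightarrow> 'u) \<Rightarrow> ('m \<Rightarrow> ('u::real_inner \<Rightarrow>\<^sub>L real)) \<Rightarrow> bool" where
  "riesz_representers q l \<longleftrightarrow> (\<forall>m v. q m \<bullet> v = blinfun_apply (l m) v)"

definition obs_matrix ::
  "('m::finite \<Rightarrow> ('u::real_inner \<Rightarrow>\<^sub>L real)) \<Rightarrow> ('n::finite \<Rightarrow> 'u) \<Rightarrow> real^'n^'m" where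
  "obs_matrix l \<zeta> = (\<chi> m n. blinfun_apply (l m) (\<zeta> n))"

definition gram_matrix :: "('m::finite \<Rightarrow> 'u::real_inner) \<Rightarrow> real^'m^'m" where
  "gram_matrix q = (\<chi> m m'. q m \<bullet> q m')"

definition weight_matrix :: "real \<Rightarrow> ('m::finite \<Rightarrow> 'u::real_inner) \<Rightarrow> real^'m^'m" where
  "weight_matrix \<xi> q = matrix_inv (\<xi> *\<^sub>R mat 1 + gram_matrix q)"

definition Q_matrix ::
  "real \<Rightarrow> ('m::finite \<Rightarrow> ('u::real_inner \<Rightarrow>\<^sub>L real)) \<Rightarrow> ('m \<Rightarrow> 'u) \<Rightarrow> ('n::finite \<Rightarrow> 'u)
    \<Rightarrow> real^'n^'n" where
  "Q_matrix \<xi> l q \<zeta> =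
     transpose (obs_matrix l \<zeta>) ** weight_matrix \<xi> q ** obs_matrix l \<zeta>"

text \<open>A norm only when the matrix is symmetric positive definite.\<close>
definition weighted_norm :: "real^'k^'k \<Rightarrow> real^'k \<Rightarrow> real" where
  "weighted_norm W x = sqrt (x \<bullet> (W *v x))"

definition spectral_norm :: "real^'n^'m \<Rightarrow> real" where
  "spectral_norm A = onorm (\<lambda>x. A *v x)"

text \<open>The infimum is taken in the reals, so the definition is meaningful only when
  \<open>\<Phi>\<close> has at least two points.\<close>
definition Lambda_nl ::
  "real \<Rightarrow> ('m::finite \<Rightarrow> ('u::real_inner \<Rightarrow>\<^sub>L real)) \<Rightarrow> ('m \<Rightarrow> 'u) \<Rightarrow> ('n::finite \<Rightarrow> 'u)
    \<Rightarrow> (real^'n) set \<Rightarrow> real" where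
  "Lambda_nl \<xi> l q \<zeta> \<Phi> =
     inverse (Inf {(weighted_norm (Q_matrix \<xi> l q \<zeta>) (z1 - z2))\<^sup>2 / (norm (z1 - z2))\<^sup>2
                   | z1 z2. z1 \<in> \<Phi> \<and> z2 \<in> \<Phi> \<and> z1 \<noteq> z2})"

end

theory Submission
  imports Defs
begin

text \<open>A minimiser over a convex set satisfies the first-order variational inequality. Testing the
  inequality for \<open>z1\<close> with \<open>z2\<close> and vice versa and adding the two gives, with \<open>d = z2 - z1\<close>,
  \<open>\<parallel>d\<parallel>\<^sub>Q\<^sup>2 \<le> d \<bullet> (L\<^sup>T W (y2 - y1))\<close>. The left side is at least \<open>\<parallel>d\<parallel>\<^sup>2 / \<Lambda>\<close> and the right side is
  bounded by Cauchy--Schwarz.\<close>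

text \<open>This concerns the quadratic form alone. Symmetry is carried separately as
  \<open>transpose W = W\<close> and enters where two cross terms have to agree.\<close>

definition pos_def :: "real^'n^'n \<Rightarrow> bool" where
  "pos_def A \<longleftrightarrow> (\<forall>x. x \<noteq> 0 \<longrightarrow> 0 < x \<bullet> (A *v x))"

lemma pos_def_nonneg: "pos_def A \<Longrightarrow> 0 \<le> x \<bullet> (A *v x)"
  by (cases "x = 0") (auto simp: pos_def_def less_imp_le)

lemma pos_def_invertible:
  fixes A :: "real^'n::finite^'n"
  assumes "pos_def A"
  shows "invertible A"
proof -
  have "x = 0" if "A *v x = 0" for x
    using assms that unfolding pos_def_def by (metis inner_zero_right less_irrefl)
  then show ?thesis
    using invertible_left_inverse matrix_left_invertible_ker by blast
qed

lemma matrix_inv_right: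
  fixes A :: "'a::semiring_1^'n::finite^'m::finite"
  assumes "invertible A"
  shows "A ** matrix_inv A = mat 1"
  using someI_ex[OF assms[unfolded invertible_def]] by (simp add: matrix_inv_def)

text \<open>Substituting \<open>x = A *v y\<close> turns the form of the inverse at \<open>x\<close>
  into the form of \<open>A\<close> at \<open>y\<close>.\<close>

lemma pos_def_matrix_inv:
  fixes A :: "real^'n::finite^'n"
  assumes "pos_def A"
  shows "pos_def (matrix_inv A)"
  unfolding pos_def_def
proof (intro allI impI)
  fix x :: "real^'n" assume "x \<noteq> 0"
  define y where "y = matrix_inv A *v x"
  have x: "x = A *v y"
    using matrix_inv_right[OF pos_def_invertible[OF assms]]
    by (simp add: y_def matrix_vector_mul_assoc)
  with \<open>x \<noteq> 0\<close> have "y \<noteq> 0" by auto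
  then have "0 < y \<bullet> (A *v y)" using assms by (simp add: pos_def_def)
  then show "0 < x \<bullet> (matrix_inv A *v x)"
    by (simp only: x[symmetric] y_def[symmetric] inner_commute[of x y])
qed

text \<open>Transposing \<open>A ** matrix_inv A = mat 1\<close> makes the transposed inverse a left
  inverse of \<open>A\<close>, and a left inverse equals a right inverse.\<close>

lemma transpose_matrix_inv_of_symmetric:
  fixes A :: "real^'n::finite^'n"
  assumes "invertible A" "transpose A = A"
  shows "transpose (matrix_inv A) = matrix_inv A"
proof -
  have "transpose (matrix_inv A) ** A = mat 1"
    using matrix_inv_right[OF assms(1)] assms(2) by (metis matrix_transpose_mul transpose_mat)
  then show ?thesis
    using matrix_inv_right[OF assms(1)] by (metis matrix_mul_assoc matrix_mul_lid matrix_mul_rid)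
qed

text \<open>The form attains a minimum on the compact unit sphere, which is positive; homogeneity
  extends the bound to all vectors. The uniform constant is what later keeps the infimum in
  \<open>Lambda_nl\<close> away from 0.\<close>

lemma pos_def_coercive:
  fixes A :: "real^'n::finite^'n"
  assumes "pos_def A"
  obtains c where "0 < c" "\<And>x. c * (norm x)\<^sup>2 \<le> x \<bullet> (A *v x)"
proof -
  obtain u :: "real^'n" where u: "norm u = 1" using vector_choose_size[of 1] by auto
  have "continuous_on (sphere 0 1) (\<lambda>x. x \<bullet> (A *v x))"
    by (intro continuous_intros linear_continuous_on matrix_vector_mul_bounded_linear)
  moreover have "sphere (0::real^'n) 1 \<noteq> {}" using u by auto
  ultimately obtain v where v: "v \<in> sphere 0 1" "\<And>x. x \<in> sphere 0 1 \<Longrightarrow> v \<bullet> (A *v v) \<le> x \<bullet> (A *v x)"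
    using continuous_attains_inf[OF compact_sphere, of 0 1 "\<lambda>x. x \<bullet> (A *v x)"] by blast
  show thesis
  proof
    have "v \<noteq> 0" using v(1) by auto
    then show "0 < v \<bullet> (A *v v)" using assms by (simp add: pos_def_def)
    fix x :: "real^'n"
    show "(v \<bullet> (A *v v)) * (norm x)\<^sup>2 \<le> x \<bullet> (A *v x)"
    proof (cases "x = 0")
      case False
      have "v \<bullet> (A *v v) \<le> (inverse (norm x) *\<^sub>R x) \<bullet> (A *v (inverse (norm x) *\<^sub>R x))"
        using False by (intro v(2)) simp
      also have "\<dots> = (x \<bullet> (A *v x)) / (norm x)\<^sup>2"
        by (simp add: matrix_vector_mult_scaleR power2_eq_square divide_simps)
      finally show ?thesis using False by (simp add: pos_le_divide_eq)
    qed simp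
  qed
qed

lemma weighted_norm_power2: "pos_def W \<Longrightarrow> (weighted_norm W x)\<^sup>2 = x \<bullet> (W *v x)"
  by (simp add: weighted_norm_def pos_def_nonneg)

lemma norm_matrix_vector_mult_le_spectral_norm: "norm (A *v x) \<le> spectral_norm A * norm x"
  for A :: "real^'n::finite^'m::finite"
  unfolding spectral_norm_def by (intro onorm matrix_vector_mul_bounded_linear)

lemma inner_gram_matrix:
  "x \<bullet> (gram_matrix q *v x) = (norm (\<Sum>i\<in>UNIV. x $ i *\<^sub>R q i))\<^sup>2"
  by (simp add: gram_matrix_def inner_vec_def matrix_vector_mult_def power2_norm_eq_inner
      inner_sum_left inner_sum_right sum_distrib_left inner_commute mult_ac)

text \<open>\<open>independent\<close> speaks of a set, the sum of an indexed family. Injectivity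
  rules out repeated vectors, so the sum can be reindexed over \<open>range l\<close> with
  coefficients read off through \<open>inv l\<close>.\<close>

lemma independent_range_sum_zeroD:
  fixes l :: "'m::finite \<Rightarrow> 'v::real_vector"
  assumes "inj l" "independent (range l)" "(\<Sum>i\<in>UNIV. x $ i *\<^sub>R l i) = 0"
  shows "x = 0"
proof -
  have "(\<Sum>v\<in>range l. x $ (inv l v) *\<^sub>R v) = 0"
    using assms(1,3) by (simp add: sum.reindex)
  then have "x $ (inv l v) = 0" if "v \<in> range l" for v
    using independentD[OF assms(2), of "range l" "\<lambda>v. x $ (inv l v)" v] that by simp
  then show ?thesis
    using assms(1) by (metis inv_f_f rangeI vec_eq_iff zero_index)
qed

text \<open>The Gram form at \<open>x\<close> is the squared norm of the combination of the
  \<open>q i\<close> with coefficients \<open>x\<close>. If that combination vanished, so would the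
  same combination of the functionals they represent, against independence.\<close>

lemma pos_def_gram_matrix_riesz:
  assumes "inj l" "independent (range l)" "riesz_representers q l"
  shows "pos_def (gram_matrix q)"
  unfolding pos_def_def
proof (intro allI impI)
  fix x :: "real^'a" assume "x \<noteq> 0"
  have "(\<Sum>i\<in>UNIV. x $ i *\<^sub>R q i) \<noteq> 0"
  proof
    assume *: "(\<Sum>i\<in>UNIV. x $ i *\<^sub>R q i) = 0"
    have "blinfun_apply (\<Sum>i\<in>UNIV. x $ i *\<^sub>R l i) v = (\<Sum>i\<in>UNIV. x $ i *\<^sub>R q i) \<bullet> v" for v
      using assms(3)
      by (simp add: riesz_representers_def inner_sum_left blinfun.sum_left blinfun.scaleR_left)
    then have "(\<Sum>i\<in>UNIV. x $ i *\<^sub>R l i) = 0"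
      by (intro blinfun_eqI) (simp add: *)
    with assms(1,2) \<open>x \<noteq> 0\<close> show False using independent_range_sum_zeroD by blast
  qed
  then show "0 < x \<bullet> (gram_matrix q *v x)" by (simp add: inner_gram_matrix)
qed

text \<open>The Gram matrix supplies strict positivity, so the case \<open>\<xi> = 0\<close> is
  covered; the shift only adds a nonnegative term.\<close>

lemma weight_matrix_spd:
  assumes "pos_def (gram_matrix q)" "0 \<le> \<xi>"
  shows "pos_def (weight_matrix \<xi> q)" "transpose (weight_matrix \<xi> q) = weight_matrix \<xi> q"
proof -
  let ?A = "\<xi> *\<^sub>R mat 1 + gram_matrix q"
  have A: "pos_def ?A"
    using assms by (auto simp: pos_def_def matrix_vector_mult_add_rdistrib
        scaleR_matrix_vector_assoc[symmetric] inner_add_right intro!: add_nonneg_pos)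
  have "transpose ?A = ?A"
    by (simp add: vec_eq_iff transpose_def mat_def gram_matrix_def inner_commute)
  then show "pos_def (weight_matrix \<xi> q)" "transpose (weight_matrix \<xi> q) = weight_matrix \<xi> q"
    unfolding weight_matrix_def
    using A pos_def_matrix_inv pos_def_invertible transpose_matrix_inv_of_symmetric by blast+
qed

lemma inner_vector_matrix_mult:
  fixes A :: "real^'n::finite^'m::finite"
  shows "x \<bullet> (y v* A) = (A *v x) \<bullet> y"
  by (metis dot_lmul_matrix inner_commute)

lemma inner_congruence:
  fixes L :: "real^'n::finite^'m::finite"
  shows "x \<bullet> ((transpose L ** W ** L) *v y) = (L *v x) \<bullet> (W *v (L *v y))"
  by (simp add: matrix_vector_mul_assoc[symmetric] inner_vector_matrix_mult)

lemma pos_def_congruence: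
  fixes L :: "real^'n::finite^'m::finite"
  assumes "pos_def W" "inj ((*v) L)"
  shows "pos_def (transpose L ** W ** L)"
  unfolding pos_def_def inner_congruence
proof (intro allI impI)
  fix x :: "real^'n" assume "x \<noteq> 0"
  then have "L *v x \<noteq> 0"
    using assms(2) by (metis injD matrix_vector_mult_0_right)
  then show "0 < (L *v x) \<bullet> (W *v (L *v x))" using assms(1) by (simp add: pos_def_def)
qed

text \<open>This is division by \<open>t\<close> followed by \<open>t\<close> tending to 0, carried
  out with one explicit small \<open>t\<close>.\<close>

lemma nonneg_linear_coeff:
  fixes p r :: real
  assumes "0 \<le> r" "\<And>t. 0 < t \<Longrightarrow> t \<le> 1 \<Longrightarrow> 0 \<le> 2 * t * p + t\<^sup>2 * r"
  shows "0 \<le> p"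
proof (rule ccontr)
  assume "\<not> 0 \<le> p"
  \<comment> \<open>This choice gives \<open>t * (r + 1) \<le> - p\<close>, hence
    \<open>2 * p + t * r \<le> p < 0\<close>. The \<open>+ 1\<close> keeps the denominator positive
    when \<open>r = 0\<close>.\<close>
  define t where "t = min 1 (- p / (r + 1))"
  have t: "0 < t" "t \<le> 1" using \<open>\<not> 0 \<le> p\<close> assms(1) by (auto simp: t_def divide_neg_pos)
  have "t * r \<le> t * (r + 1)" using t by simp
  also have "\<dots> \<le> - p / (r + 1) * (r + 1)"
    using assms(1) by (intro mult_right_mono) (auto simp: t_def)
  also have "\<dots> = - p" using assms(1) by simp
  finally have "2 * p + t * r < 0" using \<open>\<not> 0 \<le> p\<close> by simp
  then have "t * (2 * p + t * r) < 0" using t(1) by (simp add: mult_pos_neg)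
  with assms(2)[OF t] show False by (simp add: algebra_simps power2_eq_square)
qed

text \<open>By convexity the segment from \<open>z\<close> to \<open>w\<close> stays in
  \<open>\<Phi>\<close>. The increase of the objective along it is a quadratic polynomial in
  \<open>t\<close>, nonnegative on (0, 1], whose linear coefficient is twice the claimed
  quantity.\<close>

lemma least_squares_variational_inequality:
  fixes L :: "real^'n::finite^'m::finite"
  assumes W: "pos_def W" "transpose W = W"
    and "convex \<Phi>" "w \<in> \<Phi>"
    and min: "is_arg_min (\<lambda>z. (weighted_norm W (L *v z - y))\<^sup>2) (\<lambda>z. z \<in> \<Phi>) z"
  shows "0 \<le> (L *v (w - z)) \<bullet> (W *v (L *v z - y))"
proof (rule nonneg_linear_coeff)
  let ?d = "L *v (w - z)" and ?e = "L *v z - y"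
  show "0 \<le> ?d \<bullet> (W *v ?d)" using W(1) by (rule pos_def_nonneg)
  fix t :: real assume t: "0 < t" "t \<le> 1"
  have z: "z \<in> \<Phi>" using min by (simp add: is_arg_min_def)
  have "(1 - t) *\<^sub>R z + t *\<^sub>R w \<in> \<Phi>"
    using t z assms(3,4) by (intro convexD) auto
  also have "(1 - t) *\<^sub>R z + t *\<^sub>R w = z + t *\<^sub>R (w - z)" by (simp add: algebra_simps)
  finally have "?e \<bullet> (W *v ?e) \<le> (L *v (z + t *\<^sub>R (w - z)) - y) \<bullet> (W *v (L *v (z + t *\<^sub>R (w - z)) - y))"
    using min W(1) by (auto simp: is_arg_min_linorder weighted_norm_power2)
  also have "L *v (z + t *\<^sub>R (w - z)) - y = ?e + t *\<^sub>R ?d"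
    by (simp add: matrix_vector_right_distrib matrix_vector_mult_scaleR)
  also have "(?e + t *\<^sub>R ?d) \<bullet> (W *v (?e + t *\<^sub>R ?d))
      = ?e \<bullet> (W *v ?e) + t * (?d \<bullet> (W *v ?e)) + t * (?e \<bullet> (W *v ?d)) + t\<^sup>2 * (?d \<bullet> (W *v ?d))"
    by (simp only: matrix_vector_right_distrib matrix_vector_mult_scaleR inner_add_left
        inner_add_right inner_scaleR_left inner_scaleR_right) (simp add: power2_eq_square algebra_simps)
  \<comment> \<open>Symmetry of \<open>W\<close> merges the two cross terms.\<close>
  also have "?e \<bullet> (W *v ?d) = ?d \<bullet> (W *v ?e)"
    by (metis W(2) inner_commute inner_vector_matrix_mult transpose_matrix_vector)
  finally show "0 \<le> 2 * t * (?d \<bullet> (W *v ?e)) + t\<^sup>2 * (?d \<bullet> (W *v ?d))" by simp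
qed

lemma Lambda_nl_bound:
  assumes "pos_def (Q_matrix \<xi> l q \<zeta>)" "a \<in> \<Phi>" "b \<in> \<Phi>" "a \<noteq> b"
  shows "0 < Lambda_nl \<xi> l q \<zeta> \<Phi>"
    and "(norm (a - b))\<^sup>2 \<le> Lambda_nl \<xi> l q \<zeta> \<Phi> * ((a - b) \<bullet> (Q_matrix \<xi> l q \<zeta> *v (a - b)))"
proof -
  let ?Q = "Q_matrix \<xi> l q \<zeta>"
  define S where "S = {(weighted_norm ?Q (u - v))\<^sup>2 / (norm (u - v))\<^sup>2
                   | u v. u \<in> \<Phi> \<and> v \<in> \<Phi> \<and> u \<noteq> v}"
  obtain c where c: "0 < c" "\<And>x. c * (norm x)\<^sup>2 \<le> x \<bullet> (?Q *v x)"
    using pos_def_coercive[OF assms(1)] by blast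
  have le: "c \<le> s" if "s \<in> S" for s
    using that c(2) by (auto simp: S_def weighted_norm_power2[OF assms(1)] pos_le_divide_eq)
  have mem: "(weighted_norm ?Q (a - b))\<^sup>2 / (norm (a - b))\<^sup>2 \<in> S"
    using assms(2-4) by (auto simp: S_def)
  \<comment> \<open>A strictly positive infimum makes \<open>inverse\<close> a true reciprocal; at 0
    it would return the default value 0.\<close>
  have "c \<le> Inf S" using le mem by (intro cInf_greatest) auto
  then have pos: "0 < Inf S" using c(1) by simp
  have \<Lambda>: "Lambda_nl \<xi> l q \<zeta> \<Phi> = inverse (Inf S)" by (simp add: Lambda_nl_def S_def)
  show "0 < Lambda_nl \<xi> l q \<zeta> \<Phi>" using pos by (simp add: \<Lambda>)
  have "Inf S \<le> ((a - b) \<bullet> (?Q *v (a - b))) / (norm (a - b))\<^sup>2"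
    using cInf_lower[OF mem] le by (auto simp: bdd_below_def weighted_norm_power2[OF assms(1)])
  then have "Inf S * (norm (a - b))\<^sup>2 \<le> (a - b) \<bullet> (?Q *v (a - b))"
    using assms(4) by (simp add: pos_le_divide_eq)
  then show "(norm (a - b))\<^sup>2 \<le> Lambda_nl \<xi> l q \<zeta> \<Phi> * ((a - b) \<bullet> (?Q *v (a - b)))"
    using pos by (simp add: \<Lambda> field_simps)
qed

theorem proposition3p4:
  fixes l :: "'m::finite \<Rightarrow> ('u::{real_inner, complete_space} \<Rightarrow>\<^sub>L real)"
    and q :: "'m \<Rightarrow> 'u"
    and \<zeta> :: "'n::finite \<Rightarrow> 'u"
    and Z :: "'u set"
    and \<Phi> :: "(real^'n) set"
    and \<xi> :: real
    and y1 y2 :: "real^'m"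
    and z1 z2 :: "real^'n"
  assumes "inj l" and "independent (range l)"
    and "riesz_representers q l"
    and "dim Z = CARD('n)" and "orthonormal_basis_of \<zeta> Z"
    and "convex \<Phi>" and "\<exists>a\<in>\<Phi>. \<exists>b\<in>\<Phi>. a \<noteq> b"
    and "CARD('n) \<le> CARD('m)"
    and "rank (obs_matrix l \<zeta>) = min CARD('m) CARD('n)"
    and "0 \<le> \<xi>"
    and "is_arg_min (\<lambda>z. (weighted_norm (weight_matrix \<xi> q) (obs_matrix l \<zeta> *v z - y1))\<^sup>2)
           (\<lambda>z. z \<in> \<Phi>) z1"
    and "is_arg_min (\<lambda>z. (weighted_norm (weight_matrix \<xi> q) (obs_matrix l \<zeta> *v z - y2))\<^sup>2)
           (\<lambda>z. z \<in> \<Phi>) z2"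
  shows "norm (z2 - z1)
    \<le> spectral_norm (transpose (obs_matrix l \<zeta>) ** weight_matrix \<xi> q)
       * Lambda_nl \<xi> l q \<zeta> \<Phi> * norm (y1 - y2)"
proof -
  let ?L = "obs_matrix l \<zeta>" and ?W = "weight_matrix \<xi> q" and ?Q = "Q_matrix \<xi> l q \<zeta>"
  let ?\<Lambda> = "Lambda_nl \<xi> l q \<zeta> \<Phi>" and ?d = "z2 - z1"
  let ?S = "spectral_norm (transpose ?L ** ?W)"
  have W: "pos_def ?W" "transpose ?W = ?W"
    using weight_matrix_spd[OF pos_def_gram_matrix_riesz[OF assms(1-3)] assms(10)] .
  \<comment> \<open>With at least as many rows as columns, the minimum in the rank hypothesis is the
    number of columns.\<close>
  have "inj ((*v) ?L)"
    using assms(8,9) by (simp add: full_rank_injective)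
  then have Q: "pos_def ?Q"
    unfolding Q_matrix_def by (rule pos_def_congruence[OF W(1)])
  have z: "z1 \<in> \<Phi>" "z2 \<in> \<Phi>"
    using assms(11,12) by (simp_all add: is_arg_min_def)
  \<comment> \<open>The two distinct points come from the hypothesis on \<open>\<Phi>\<close>,
    because \<open>z1\<close> and \<open>z2\<close> may coincide.\<close>
  have \<Lambda>: "0 < ?\<Lambda>" using assms(7) Lambda_nl_bound(1)[OF Q] by blast
  have "0 \<le> (?L *v ?d) \<bullet> (?W *v (?L *v z1 - y1))"
    by (rule least_squares_variational_inequality[OF W assms(6) z(2) assms(11)])
  moreover have "0 \<le> (?L *v (z1 - z2)) \<bullet> (?W *v (?L *v z2 - y2))"
    by (rule least_squares_variational_inequality[OF W assms(6) z(1) assms(12)])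
  \<comment> \<open>The two residuals differ by \<open>y2 - y1\<close> minus
    \<open>?L *v ?d\<close>; the latter yields the quadratic term on the left.\<close>
  ultimately have "?d \<bullet> (?Q *v ?d) \<le> (?L *v ?d) \<bullet> (?W *v (y2 - y1))"
    unfolding Q_matrix_def inner_congruence
    by (simp add: matrix_vector_mult_diff_distrib inner_diff_left inner_diff_right)
  also have "\<dots> = ?d \<bullet> ((transpose ?L ** ?W) *v (y2 - y1))"
    by (simp add: matrix_vector_mul_assoc[symmetric] inner_vector_matrix_mult)
  also have "\<dots> \<le> norm ?d * (?S * norm (y1 - y2))"
    unfolding norm_minus_commute[of y1 y2]
    by (rule order_trans[OF norm_cauchy_schwarz mult_left_mono])
      (rule norm_matrix_vector_mult_le_spectral_norm, simp)
  finally have *: "?d \<bullet> (?Q *v ?d) \<le> norm ?d * (?S * norm (y1 - y2))" .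
  show ?thesis
  proof (cases "z1 = z2")
    case True
    have "0 \<le> ?S"
      unfolding spectral_norm_def by (intro onorm_pos_le matrix_vector_mul_bounded_linear)
    with True \<Lambda> show ?thesis by simp
  next
    case False
    have "(norm ?d)\<^sup>2 \<le> ?\<Lambda> * (?d \<bullet> (?Q *v ?d))"
      using Lambda_nl_bound(2)[OF Q z(2,1)] False by simp
    also have "\<dots> \<le> ?\<Lambda> * (norm ?d * (?S * norm (y1 - y2)))"
      using * \<Lambda> by (intro mult_left_mono) auto
    finally have "norm ?d * norm ?d \<le> norm ?d * (?S * ?\<Lambda> * norm (y1 - y2))"
      by (simp add: power2_eq_square mult_ac)
    \<comment> \<open>The factor \<open>norm ?d\<close> is positive here and cancels.\<close>
    then show ?thesis using False by (simp only: mult_le_cancel_left) simp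
  qed
qed

end
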